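(* For all sufficiently large integers $n$, we have $cs(n) \geq (7/4)^n$.
   Context: All graphs are finite, simple, undirected, unweighted, and loopless. For a graph $G$, $L(G) = D(G) - A(G)$ is its Laplacian matrix. $G$ is $\{-1,0,1\}$-diagonalizable if there is a basis of eigenvectors of $L(G)$ whose entries all belong to $\{-1,0,1\}$; equivalently, there is an invertible matrix $P$ with all entries in $\{-1,0,1\}$ such that $P^{-1}L(G)P$ is diagonal. $cs(n)$ denotes the number, up to isomorphism, of connected $\{-1,0,1\}$-diagonalizable graphs on $n$ vertices. *)

theory Defs
  imports
    Complex_Main
    "Graph_Theory.Pair_Digraph"
    "Graph_Theory.Digraph_Isomorphism"
    "Jordan_Normal_Form.VS_Connect"
    "Jordan_Normal_Form.Char_Poly"
begin

text \<open>
  A simple graph is a \<^locale>\<open>pair_graph\<close>: a finite, loopless digraph without parallel arcs whose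
  arc relation is symmetric, an undirected edge being a pair of opposite arcs.  The matrices
  below are meant for graphs with vertex set \<open>{..<n}\<close>, whose vertices serve as matrix indices.
\<close>

definition adjacency_mat :: "nat \<Rightarrow> nat pair_pre_digraph \<Rightarrow> real mat" where
  "adjacency_mat n G = mat n n (\<lambda>(i, j). if (i, j) \<in> parcs G then 1 else 0)"

definition degree_mat :: "nat \<Rightarrow> nat pair_pre_digraph \<Rightarrow> real mat" where
  "degree_mat n G = mat_diag n (\<lambda>i. real (out_degree (with_proj G) i))"

definition laplacian_mat :: "nat \<Rightarrow> nat pair_pre_digraph \<Rightarrow> real mat" where
  "laplacian_mat n G = degree_mat n G - adjacency_mat n G"

definition sign_diagonalizable :: "nat \<Rightarrow> nat pair_pre_digraph \<Rightarrow> bool" where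
  "sign_diagonalizable n G \<longleftrightarrow>
     (\<exists>B. vectorspace.basis class_ring (module_vec TYPE(real) n) B \<and>
          (\<forall>v\<in>B. (\<exists>k. eigenvector (laplacian_mat n G) v k) \<and> (\<forall>i<n. v $ i \<in> {-1, 0, 1})))"

text \<open>
  Every graph on \<open>n\<close> vertices is isomorphic to one with vertex set \<open>{..<n}\<close>, so isomorphism
  classes are counted among the labelled graphs on that set.  Connectedness is qualified to
  distinguish it from the topological notion.
\<close>

definition conn_sign_diag_graphs :: "nat \<Rightarrow> nat pair_pre_digraph set" where
  "conn_sign_diag_graphs n =
     {G. pair_graph G \<and> pverts G = {..<n} \<and> Digraph_Component.connected (with_proj G) \<and>
         sign_diagonalizable n G}"

definition cs :: "nat \<Rightarrow> nat" where
  "cs n = card (conn_sign_diag_graphs n //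
     {(G, H) \<in> conn_sign_diag_graphs n \<times> conn_sign_diag_graphs n.
        digraph_iso (with_proj G) (with_proj H)})"

end

theory Submission
  imports Defs "HOL-Real_Asymp.Real_Asymp"
begin

text \<open>
  The bound comes from the Cayley graphs of the elementary abelian groups $(Z/2)^d$.  Put
  $N = 2^d$.  Every connection set $S$ of such a group yields a graph whose Laplacian is
  diagonalized by the $N$ characters of the group, and these take only the values $1$ and $-1$.
  So all $2^{N-1}$ Cayley graphs on $N$ vertices are $\{-1,0,1\}$-diagonalizable, which is a growth
  rate of $2 > 7/4$, as long as passing to isomorphism classes loses only a factor $2^{o(N)}$ and
  numbers of vertices that are not powers of $2$ can be reached.

  Isomorphism classes.  Call $S$ separated when every vertex is determined by its adjacencies to
  the $b = 6d + 4$ vertices $0, \ldots, b - 1$. A union bound over pairs of vertices shows that at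
  least half of the $S$ that contain the $d$ standard generators and not $0$ are separated
  (\<open>card_good_sets_ge\<close>). For a separated $S$, an automorphism of its Cayley graph is
  determined by $b$ of its values, and a set $S'$ with an isomorphic Cayley graph is determined by
  the $d$ automorphisms that are the pulled back generating translations, together with one
  vertex. So each isomorphism class has at most $N^{db+1} = 2^{O(d^3)}$ members
  (\<open>card_cayley_iso_le\<close>), and $2^{N - O(d^3)}$ pairwise non-isomorphic connected
  Cayley graphs on $N$ vertices remain (\<open>exists_cayley_transversal\<close>).

  Arbitrary $n$.  Choose $d$ with $16 N \le n < 32 N$, take a disjoint union of $q$ Cayley graphs on
  $N$ vertices and of at least $N$ isolated vertices, $n$ vertices in all, and pass to the complement.
  Nonconstant eigenvectors of a Laplacian survive complementation if their entries sum to $0$.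
  Nontrivial characters of a component do have sum $0$.  The vectors with sum $0$ that are constant on
  each component are spanned by differences of two isolated vertices and differences of a component
  and $N$ isolated vertices.  Together with the constant vector these span everything (\<open>block_cograph_sign_diagonalizable\<close>).  The complement is connected, and its
  isomorphism class determines the isomorphism classes of the $q$ components
  (\<open>block_cograph_iso_imp_cayley_iso\<close>).

  With $T$ isomorphism classes to choose from this gives at least
  ${T \choose q} \ge (T/q)^q = 2^{q N (1 - o(1))}$ graphs.  As the isolated vertices make up at most
  $2N$ of the $n \ge 16N$ vertices, $qN$ is at least $15n/17$, while $(7/4)^n \le 2^{13n/16}$ and
  $13/16 < 15/17$.
\<close>

unbundle bit_operations_syntax

section \<open>Spanning by sign eigenvectors\<close>

text \<open>
  The span is a span of functions rather than of matrix-library vectors, so that vertices outside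
  \<open>{..<n}\<close> need no bookkeeping and linear combinations are plain arithmetic.  The sum in \<open>eigen\<close> is
  the Laplacian of \<open>G\<close> applied to \<open>f\<close>, at the vertex \<open>x\<close>.
\<close>

inductive sign_span :: "nat \<Rightarrow> nat pair_pre_digraph \<Rightarrow> (nat \<Rightarrow> real) \<Rightarrow> bool" for n G where
  eigen: "\<lbrakk>\<And>x. x < n \<Longrightarrow> f x \<in> {-1, 0, 1};
           \<And>x. x < n \<Longrightarrow> (\<Sum>y<n. if (x, y) \<in> parcs G then f x - f y else 0) = k * f x\<rbrakk>
          \<Longrightarrow> sign_span n G f"
| add: "sign_span n G f \<Longrightarrow> sign_span n G g \<Longrightarrow> sign_span n G (\<lambda>x. f x + g x)"
| scale: "sign_span n G f \<Longrightarrow> sign_span n G (\<lambda>x. c * f x)"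

lemma laplacian_mult_vec:
  assumes G: "parcs G \<subseteq> {..<n} \<times> {..<n}" and x: "x < n"
  shows "(laplacian_mat n G *\<^sub>v vec n f) $ x
    = (\<Sum>y<n. if (x, y) \<in> parcs G then f x - f y else 0)"
proof -
  have "out_arcs (with_proj G) x = Pair x ` {y. y < n \<and> (x, y) \<in> parcs G}"
    using G by (auto simp: out_arcs_def)
  then have deg: "real (out_degree (with_proj G) x) = (\<Sum>y<n. if (x, y) \<in> parcs G then 1 else 0)"
    by (simp add: out_degree_def card_image inj_on_def sum.If_cases lessThan_def Int_def)
  have "(laplacian_mat n G *\<^sub>v vec n f) $ x
    = (\<Sum>y<n. ((if x = y then real (out_degree (with_proj G) y) else 0)
              - (if (x, y) \<in> parcs G then 1 else 0)) * f y)"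
    using x by (simp add: laplacian_mat_def degree_mat_def adjacency_mat_def mat_diag_def
        mult_mat_vec_def scalar_prod_def row_def lessThan_atLeast0)
  also have "\<dots> = real (out_degree (with_proj G) x) * f x
      - (\<Sum>y<n. (if (x, y) \<in> parcs G then 1 else 0) * f y)"
  proof -
    have "(\<Sum>y<n. (if x = y then real (out_degree (with_proj G) y) else 0) * f y)
        = (\<Sum>y<n. if x = y then real (out_degree (with_proj G) y) * f y else 0)"
      by (rule sum.cong) auto
    then show ?thesis using x by (simp add: left_diff_distrib sum_subtractf)
  qed
  also have "\<dots> = (\<Sum>y<n. if (x, y) \<in> parcs G then f x - f y else 0)"
    unfolding deg sum_distrib_right sum_subtractf[symmetric] by (rule sum.cong) auto
  finally show ?thesis .
qed

text \<open>
  It suffices to generate the unit vectors from sign eigenvectors: the set of all sign eigenvectors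
  is finite, so if it spans the space then a minimal spanning subset of it is a basis.
\<close>

lemma sign_diagonalizableI:
  assumes G: "parcs G \<subseteq> {..<n} \<times> {..<n}"
    and unit: "\<And>a. a < n \<Longrightarrow> sign_span n G (\<lambda>x. if x = a then 1 else 0)"
  shows "sign_diagonalizable n G"
proof -
  interpret vec_space "TYPE(real)" n .
  define L where "L = laplacian_mat n G"
  have L: "L \<in> carrier_mat n n"
    unfolding L_def laplacian_mat_def adjacency_mat_def by (rule minus_carrier_mat) simp
  define B where "B = {v \<in> carrier_vec n. (\<exists>k. eigenvector L v k) \<and> (\<forall>i<n. v $ i \<in> {-1, 0, 1})}"
  have B: "B \<subseteq> carrier_vec n" by (auto simp: B_def)
  have "B \<subseteq> (\<lambda>f. vec n f) ` ({..<n} \<rightarrow>\<^sub>E {-1, 0, 1})"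
  proof
    fix v assume v: "v \<in> B"
    have "v = vec n (restrict (vec_index v) {..<n})"
      using v by (intro eq_vecI) (auto simp: B_def)
    moreover have "restrict (vec_index v) {..<n} \<in> {..<n} \<rightarrow>\<^sub>E {-1, 0, 1}"
      using v by (auto simp: B_def)
    ultimately show "v \<in> (\<lambda>f. vec n f) ` ({..<n} \<rightarrow>\<^sub>E {-1, 0, 1})" by blast
  qed
  then have finB: "finite B" by (rule finite_subset) (intro finite_imageI finite_PiE; simp)
  have span: "vec n f \<in> span B" if "sign_span n G f" for f
    using that
  proof induction
    case (eigen f k)
    show ?case
    proof (cases "vec n f = 0\<^sub>v n")
      case True
      then show ?thesis using span_zero by simp
    next
      case False
      have "L *\<^sub>v vec n f = k \<cdot>\<^sub>v vec n f"
        using L laplacian_mult_vec[OF G] eigen(2) by (intro eq_vecI) (auto simp: L_def simp del: index_mult_mat_vec)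
      then have "vec n f \<in> B"
        using False L eigen(1) unfolding B_def eigenvector_def by auto
      then show ?thesis using in_own_span[OF B] by blast
    qed
  next
    case (add f g)
    have "vec n (\<lambda>x. f x + g x) = vec n f + vec n g" by (intro eq_vecI) auto
    then show ?case using span_add1[OF B add.IH] by simp
  next
    case (scale f c)
    have "vec n (\<lambda>x. c * f x) = c \<cdot>\<^sub>v vec n f" by (intro eq_vecI) auto
    then show ?case using smult_in_span[OF B scale.IH] by simp
  qed
  have "set (unit_vecs n) \<subseteq> span B"
  proof
    fix u :: "real vec" assume "u \<in> set (unit_vecs n)"
    then obtain a where a: "a < n" "u = unit_vec n a" by (auto simp: unit_vecs_def)
    have "u = vec n (\<lambda>x. if x = a then 1 else 0)" unfolding a(2) unit_vec_def by simp
    then show "u \<in> span B" using span[OF unit[OF a(1)]] by simp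
  qed
  then have "span (set (unit_vecs n)) \<subseteq> span B" using span_is_subset[OF _ span_is_submodule[OF B]] by blast
  then have gen: "span B = carrier_vec n"
    using span_unit_vecs_is_carrier span_is_subset2[OF B] by auto
  obtain C where C: "C \<subseteq> B" "minimal C (\<lambda>S. S \<subseteq> carrier_vec n \<and> span S = carrier_vec n)"
    using minimal_exists[of B "\<lambda>S. S \<subseteq> carrier_vec n \<and> span S = carrier_vec n"] finB B gen by auto
  have "basis C" using min_gen_is_basis[of C] C(2) by simp
  moreover have "\<forall>v\<in>C. (\<exists>k. eigenvector (laplacian_mat n G) v k) \<and> (\<forall>i<n. v $ i \<in> {-1, 0, 1})"
    using C(1) by (auto simp: B_def L_def)
  ultimately show ?thesis unfolding sign_diagonalizable_def by blast
qed

section \<open>The group of binary words and its characters\<close>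

lemma xor_less_two_power: "x < 2 ^ d \<Longrightarrow> y < 2 ^ d \<Longrightarrow> x XOR y < (2::nat) ^ d"
  by (metis take_bit_nat_eq_self take_bit_nat_eq_self_iff take_bit_xor)

lemma xor_cancel_left: "x XOR (x XOR y) = (y::nat)"
  by (simp flip: xor.assoc)

lemma xor_eq_zero_iff: "x XOR y = 0 \<longleftrightarrow> x = (y::nat)"
  by (metis xor.right_neutral xor_cancel_left xor_self_eq)

lemma bij_betw_xor: "a < 2 ^ d \<Longrightarrow> bij_betw (\<lambda>x. a XOR x) {..<2 ^ d} {..<(2::nat) ^ d}"
  by (rule bij_betw_byWitness[where f' = "\<lambda>x. a XOR x"]) (auto simp: xor_cancel_left xor_less_two_power)

lemma exists_bit_less:
  assumes "x < 2 ^ d" "y < (2::nat) ^ d" "x \<noteq> y"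
  obtains k where "k < d" "bit x k \<noteq> bit y k"
proof -
  obtain k where k: "bit x k \<noteq> bit y k" using assms(3) bit_eqI by blast
  have "\<not> bit z k" if "z < 2 ^ d" "d \<le> k" for z :: nat
    using that by (metis bit_take_bit_iff leD take_bit_nat_eq_self_iff)
  then have "k < d" using k assms by (meson not_le)
  with k that show ?thesis by blast
qed

text \<open>
  The group $(Z/2)^d$ is modelled on the numbers below \<open>2 ^ d\<close> with bitwise exclusive or, so that
  group elements serve directly as vertices.  Its characters are exactly its homomorphisms to
  \<open>{-1, 1}\<close>.
\<close>

definition character :: "nat \<Rightarrow> (nat \<Rightarrow> real) \<Rightarrow> bool" where
  "character d \<chi> \<longleftrightarrow> (\<forall>x<2 ^ d. \<chi> x \<in> {-1, 1}) \<and> (\<forall>x<2 ^ d. \<forall>y<2 ^ d. \<chi> (x XOR y) = \<chi> x * \<chi> y)"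

definition bit_sign :: "nat \<Rightarrow> nat \<Rightarrow> real" where
  "bit_sign k x = (if bit x k then -1 else 1)"

lemma character_one: "character d (\<lambda>x. 1)"
  by (simp add: character_def)

lemma character_mult_bit_sign: "character d \<chi> \<Longrightarrow> character d (\<lambda>x. \<chi> x * bit_sign k x)"
  by (auto simp: character_def bit_sign_def bit_xor_iff)

text \<open>
  Translating the summation variable by \<open>a\<close> changes the sign of the sum.
\<close>

lemma sum_character_eq_zero:
  assumes \<chi>: "character d \<chi>" and a: "a < 2 ^ d" "\<chi> a = -1"
  shows "(\<Sum>x<2 ^ d. \<chi> x) = 0"
proof -
  have "(\<Sum>x<2 ^ d. \<chi> x) = (\<Sum>x<2 ^ d. \<chi> (a XOR x))"
    using sum.reindex_bij_betw[OF bij_betw_xor[OF a(1)], of \<chi>] by simp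
  also have "\<dots> = (\<Sum>x<2 ^ d. - \<chi> x)"
    using \<chi> a by (intro sum.cong) (auto simp: character_def)
  finally show ?thesis by (simp add: sum_negf)
qed

text \<open>
  The indicator of \<open>a\<close> is the normalized product of the factors \<open>1 + bit_sign k a * bit_sign k x\<close>, and
  expanding it produces characters only.  Phrased for an arbitrary linearly closed predicate \<open>P\<close>, so
  that the functions can later be transported to a single block of a larger vertex set.
\<close>

lemma characters_span:
  assumes add: "\<And>f g. P f \<Longrightarrow> P g \<Longrightarrow> P (\<lambda>x. f x + g x)"
    and scale: "\<And>c f. P f \<Longrightarrow> P (\<lambda>x. c * f x)"
    and char: "\<And>\<chi>. character d \<chi> \<Longrightarrow> P \<chi>"
    and a: "a < 2 ^ d"
  shows "\<exists>g. P g \<and> (\<forall>x<2 ^ d. g x = (if x = a then 1 else 0))"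
proof -
  let ?p = "\<lambda>m x. \<Prod>k<m. 1 + bit_sign k a * bit_sign k x"
  have P: "P (\<lambda>x. \<chi> x * ?p m x)" if "character d \<chi>" for m \<chi>
    using that
  proof (induction m arbitrary: \<chi>)
    case 0
    then show ?case using char by simp
  next
    case (Suc m)
    have "P (\<lambda>x. \<chi> x * ?p m x + bit_sign m a * ((\<chi> x * bit_sign m x) * ?p m x))"
      using Suc.IH[OF Suc.prems] scale[OF Suc.IH[OF character_mult_bit_sign[OF Suc.prems, of m]]]
      by (rule add)
    then show ?case by (simp add: algebra_simps)
  qed
  have val: "?p d x = (if x = a then 2 ^ d else 0)" if x: "x < 2 ^ d" for x
  proof (cases "x = a")
    case True
    have "bit_sign k a * bit_sign k a = 1" for k by (simp add: bit_sign_def)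
    with True show ?thesis by simp
  next
    case False
    then obtain k where "k < d" "bit x k \<noteq> bit a k" using exists_bit_less[OF x a] by blast
    then have "k \<in> {..<d}" "1 + bit_sign k a * bit_sign k x = 0" by (auto simp: bit_sign_def)
    then have "?p d x = 0" by (meson finite_lessThan prod_zero)
    with False show ?thesis by simp
  qed
  have "P (\<lambda>x. (1 / 2 ^ d) * (1 * ?p d x))" by (intro scale P character_one)
  then show ?thesis using val by (intro exI[of _ "\<lambda>x. (1 / 2 ^ d) * (1 * ?p d x)"]) auto
qed

text \<open>
  The powers of \<open>2\<close> generate the group.
\<close>

lemma xor_induct [consumes 1, case_names zero flip]:
  assumes "x < (2::nat) ^ d" "P 0"
    and flip: "\<And>x k. \<lbrakk>x < 2 ^ d; k < d; P x\<rbrakk> \<Longrightarrow> P (x XOR 2 ^ k)"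
  shows "P x"
proof -
  have "m \<le> d \<Longrightarrow> x < 2 ^ m \<Longrightarrow> P x" for m x
  proof (induction m arbitrary: x)
    case 0
    then show ?case using assms(2) by simp
  next
    case (Suc m)
    show ?case
    proof (cases "x < 2 ^ m")
      case True
      then show ?thesis using Suc by simp
    next
      case False
      let ?y = "take_bit m x"
      have y: "?y < 2 ^ m" by simp
      have "x div 2 ^ m = 1" using False Suc.prems(2) by (simp add: div_nat_eqI)
      then have bm: "bit x m" by (simp add: bit_iff_odd)
      have "\<not> bit x k" if "m < k" for k
        using Suc.prems(2) that by (metis Suc_leI bit_take_bit_iff leD take_bit_nat_eq_self_iff)
      then have "x = ?y XOR 2 ^ m"
        using bm by (intro bit_eqI) (auto simp: bit_simps, metis linorder_neqE_nat)
      moreover have "?y < 2 ^ d"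
        using y Suc.prems(1) by (meson Suc_leD less_le_trans one_le_numeral power_increasing)
      ultimately show ?thesis using flip[of ?y m] Suc y by (metis Suc_leD Suc_le_lessD)
    qed
  qed
  with assms(1) show ?thesis by blast
qed

section \<open>Complements of disjoint unions of Cayley graphs\<close>

text \<open>
  The disjoint union of the Cayley graphs of \<open>S 0, ..., S (q - 1)\<close>: block \<open>i\<close> consists of the vertices
  from \<open>i * 2 ^ d\<close> to \<open>(i + 1) * 2 ^ d - 1\<close>, and vertices from \<open>q * 2 ^ d\<close> on are isolated.
\<close>

definition block_adj :: "nat \<Rightarrow> nat \<Rightarrow> (nat \<Rightarrow> nat set) \<Rightarrow> nat \<Rightarrow> nat \<Rightarrow> bool" where
  "block_adj d q S x y \<longleftrightarrow> x div 2 ^ d = y div 2 ^ d \<and> x div 2 ^ d < q \<and>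
     (x mod 2 ^ d) XOR (y mod 2 ^ d) \<in> S (x div 2 ^ d)"

definition block_cograph :: "nat \<Rightarrow> nat \<Rightarrow> nat \<Rightarrow> (nat \<Rightarrow> nat set) \<Rightarrow> nat pair_pre_digraph" where
  "block_cograph n d q S = \<lparr>pverts = {..<n},
     parcs = {(x, y). x < n \<and> y < n \<and> x \<noteq> y \<and> \<not> block_adj d q S x y}\<rparr>"

lemma block_adj_sym: "block_adj d q S x y \<longleftrightarrow> block_adj d q S y x"
  by (auto simp: block_adj_def xor.commute)

text \<open>
  If \<open>L\<close> is the Laplacian of a graph and \<open>J\<close> the all-ones matrix, the complement has the Laplacian
  \<open>n - J - L\<close>, and \<open>J\<close> annihilates the functions with sum \<open>0\<close>.
\<close>

lemma block_cograph_sign_spanI: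
  assumes sgn: "\<And>x. x < n \<Longrightarrow> f x \<in> {-1, 0, 1}"
    and sum: "(\<Sum>x<n. f x) = 0"
    and eig: "\<And>x. x < n \<Longrightarrow> (\<Sum>y<n. if block_adj d q S x y then f x - f y else 0) = \<mu> * f x"
  shows "sign_span n (block_cograph n d q S) f"
proof (rule sign_span.eigen[where k = "real n - \<mu>"])
  fix x assume x: "x < n"
  have "(\<Sum>y<n. if (x, y) \<in> parcs (block_cograph n d q S) then f x - f y else 0)
      = (\<Sum>y<n. (f x - f y) - (if block_adj d q S x y then f x - f y else 0))"
    using x by (intro sum.cong) (auto simp: block_cograph_def)
  also have "\<dots> = (real n - \<mu>) * f x"
    using sum eig[OF x] by (simp add: sum_subtractf algebra_simps)
  finally show "(\<Sum>y<n. if (x, y) \<in> parcs (block_cograph n d q S) then f x - f y else 0)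
      = (real n - \<mu>) * f x" .
qed (use sgn in auto)

lemma sum_block:
  fixes h :: "nat \<Rightarrow> real"
  assumes "0 < N" "(i + 1) * N \<le> n"
  shows "(\<Sum>x<n. if x div N = i then h (x mod N) else 0) = (\<Sum>x<N. h x)"
proof -
  have "{x. x < n \<and> x div N = i} = (\<lambda>x. i * N + x) ` {..<N}"
  proof (intro Set.set_eqI iffI)
    fix x assume "x \<in> {x. x < n \<and> x div N = i}"
    then have "x = i * N + x mod N" "x mod N < N" using assms(1) by auto
    then show "x \<in> (\<lambda>x. i * N + x) ` {..<N}" by blast
  qed (use assms in auto)
  then have *: "{..<n} \<inter> {x. x div N = i} = (\<lambda>x. i * N + x) ` {..<N}" by auto
  have "(\<Sum>x<n. if x div N = i then h (x mod N) else 0) = (\<Sum>x\<in>{..<n} \<inter> {x. x div N = i}. h (x mod N))"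
    by (simp add: sum.If_cases)
  also have "\<dots> = (\<Sum>x<N. h x)"
    unfolding * by (subst sum.reindex) (auto simp: inj_on_def)
  finally show ?thesis .
qed

text \<open>
  A character \<open>\<chi>\<close> is an eigenfunction of a Cayley graph because
  \<open>\<chi> x - \<chi> (x XOR s) = \<chi> x * (1 - \<chi> s)\<close>; being nontrivial, it has sum \<open>0\<close>.
\<close>

lemma block_character_span:
  assumes n: "q * 2 ^ d \<le> n" and i: "i < q"
    and \<chi>: "character d \<chi>" and a: "a < 2 ^ d" "\<chi> a = -1"
  shows "sign_span n (block_cograph n d q S) (\<lambda>x. if x div 2 ^ d = i then \<chi> (x mod 2 ^ d) else 0)"
proof (rule block_cograph_sign_spanI)
  let ?N = "2 ^ d :: nat"
  let ?\<mu> = "\<Sum>s<?N. if s \<in> S i then 1 - \<chi> s else 0"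
  let ?f = "\<lambda>x. if x div 2 ^ d = i then \<chi> (x mod 2 ^ d) else 0"
  have "(i + 1) * ?N \<le> q * ?N" using i by (intro mult_right_mono) auto
  with n have iN: "(i + 1) * ?N \<le> n" by linarith
  show "(\<Sum>x<n. ?f x) = 0"
    using sum_character_eq_zero[OF \<chi> a] sum_block[OF _ iN, of \<chi>] by simp
  fix x assume "x < n"
  have "\<chi> z \<in> {-1, 1}" if "z < 2 ^ d" for z using \<chi> that unfolding character_def by blast
  from this[of "x mod 2 ^ d"] show "?f x \<in> {-1, 0, 1}" by auto
  show "(\<Sum>y<n. if block_adj d q S x y then ?f x - ?f y else 0) = ?\<mu> * ?f x"
  proof (cases "x div 2 ^ d = i")
    case False
    then show ?thesis by (auto simp: block_adj_def intro!: sum.neutral)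
  next
    case True
    let ?x = "x mod 2 ^ d"
    have x: "?x < 2 ^ d" by simp
    have "(\<Sum>y<n. if block_adj d q S x y then ?f x - ?f y else 0)
        = (\<Sum>y<n. if y div ?N = i then (\<lambda>y. if ?x XOR y \<in> S i then \<chi> ?x - \<chi> y else 0) (y mod ?N) else 0)"
      using True i by (intro sum.cong) (auto simp: block_adj_def)
    also have "\<dots> = (\<Sum>y<?N. if ?x XOR y \<in> S i then \<chi> ?x - \<chi> y else 0)"
      using iN by (intro sum_block) auto
    also have "\<dots> = (\<Sum>s<?N. if ?x XOR (?x XOR s) \<in> S i then \<chi> ?x - \<chi> (?x XOR s) else 0)"
      by (rule sum.reindex_bij_betw[OF bij_betw_xor[OF x], symmetric])
    also have "\<dots> = (\<Sum>s<?N. \<chi> ?x * (if s \<in> S i then 1 - \<chi> s else 0))"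
      using \<chi> x by (intro sum.cong) (auto simp: character_def xor_cancel_left algebra_simps)
    also have "\<dots> = ?\<mu> * ?f x" using True by (simp add: sum_distrib_left mult.commute)
    finally show ?thesis .
  qed
qed

lemma sign_span_sum:
  assumes "finite A" "A \<noteq> {}" "\<And>i. i \<in> A \<Longrightarrow> sign_span n G (f i)"
  shows "sign_span n G (\<lambda>x. \<Sum>i\<in>A. f i x)"
  using assms
proof (induction A rule: finite_ne_induct)
  case (insert i A)
  then have "sign_span n G (\<lambda>x. f i x + (\<Sum>i\<in>A. f i x))" by (intro sign_span.add) auto
  then show ?case using insert by simp
qed simp

text \<open>
  At least one whole block of isolated vertices is available, which supplies a vector that balances
  the indicator of any other block.
\<close>

theorem block_cograph_sign_diagonalizable:
  assumes n: "(q + 1) * 2 ^ d \<le> n" and q: "0 < q"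
  shows "sign_diagonalizable n (block_cograph n d q S)"
proof -
  let ?N = "2 ^ d :: nat" and ?G = "block_cograph n d q S"
  let ?unit = "\<lambda>a x. if x = a then 1 else 0 :: real"
  let ?block = "\<lambda>i (x::nat). if x div ?N = i then 1 else 0 :: real"
  have qn: "q * ?N \<le> n" "q * ?N < n" using n by (auto simp: add_mult_distrib) (metis add.commute add_lessD1 le_neq_implies_less less_add_same_cancel1 not_add_less2 zero_less_numeral zero_less_power)
  have isolated: "\<not> block_adj d q S x y" "\<not> block_adj d q S y x" if "q * ?N \<le> y" for x y
  proof -
    have "\<not> y div ?N < q" using that by (simp add: div_less_iff_less_mult)
    then show "\<not> block_adj d q S x y" "\<not> block_adj d q S y x" by (auto simp: block_adj_def)
  qed
  have sum_all: "sign_span n ?G (\<lambda>x. if x < n then 1 else 0)"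
    by (rule sign_span.eigen[where k = 0]) (auto intro!: sum.neutral)
  \<comment> \<open>A difference of two isolated vertices is in the kernel of the Laplacian of the union.\<close>
  have singles: "sign_span n ?G (\<lambda>x. ?unit a x - ?unit b x)"
    if "q * ?N \<le> a" "a < n" "q * ?N \<le> b" "b < n" for a b
    using that isolated by (intro block_cograph_sign_spanI[where \<mu> = 0])
      (auto simp: sum_subtractf intro!: sum.neutral)
  \<comment> \<open>So is a difference of two blocks; block \<open>q\<close> consists of isolated vertices.\<close>
  have balance: "sign_span n ?G (\<lambda>x. ?block q x - ?block i x)" if i: "i < q" for i
  proof (rule block_cograph_sign_spanI[where \<mu> = 0])
    have "(i + 1) * ?N \<le> q * ?N" using i by (intro mult_right_mono) auto
    with qn have iN: "(i + 1) * ?N \<le> n" by linarith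
    show "(\<Sum>x<n. ?block q x - ?block i x) = 0"
      using sum_block[OF _ iN, of "\<lambda>_. 1"] sum_block[OF _ n, of "\<lambda>_. 1"] by (simp add: sum_subtractf)
    show "(\<Sum>y<n. if block_adj d q S x y then (?block q x - ?block i x) - (?block q y - ?block i y) else 0)
        = 0 * (?block q x - ?block i x)" if "x < n" for x
      by (auto simp: block_adj_def intro!: sum.neutral)
  qed auto
  \<comment> \<open>Adding all balancing vectors to the all-ones vector leaves a function that is positive on the
      isolated vertices and zero elsewhere; its weight can then be moved onto one vertex \<open>a\<close>.\<close>
  have single: "sign_span n ?G (?unit a)" if a: "q * ?N \<le> a" "a < n" for a
  proof -
    let ?c = "\<lambda>b. if b div ?N = q then real q + 1 else 1"
    let ?T = "{q * ?N..<n}"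
    have T: "?T \<noteq> {}" "finite ?T" using qn by auto
    have "sign_span n ?G (\<lambda>x. (if x < n then 1 else 0) + (\<Sum>i<q. ?block q x - ?block i x))"
      using q by (intro sign_span.add sum_all sign_span_sum balance) auto
    moreover have "(if x < n then 1 else 0) + (\<Sum>i<q. ?block q x - ?block i x)
        = (\<Sum>b\<in>?T. ?c b * ?unit b x)" for x
    proof -
      have 1: "(\<Sum>b\<in>?T. ?c b * ?unit b x) = (if x \<in> ?T then ?c x else 0)"
      proof -
        have "(\<Sum>b\<in>?T. ?c b * ?unit b x) = (\<Sum>b\<in>?T. if x = b then ?c b else 0)"
          by (intro sum.cong) auto
        then show ?thesis by simp
      qed
      have 2: "(\<Sum>i<q. ?block i x) = (if x < q * ?N then 1 else 0)"
        by (simp add: div_less_iff_less_mult)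
      have 3: "x < n" if "x div ?N = q"
      proof -
        have "x < (q + 1) * ?N" using that by (metis Suc_eq_plus1 div_less_iff_less_mult lessI pos2 zero_less_power)
        with n show ?thesis by linarith
      qed
      have 4: "x div ?N = q \<Longrightarrow> \<not> x < q * ?N"
        by (simp add: div_less_iff_less_mult[symmetric])
      show ?thesis unfolding 1 sum_subtractf 2 using 3 4 qn by auto
    qed
    ultimately have A: "sign_span n ?G (\<lambda>x. \<Sum>b\<in>?T. ?c b * ?unit b x)" by simp
    have B: "sign_span n ?G (\<lambda>x. \<Sum>b\<in>?T. ?c b * (?unit a x - ?unit b x))"
      using a T by (intro sign_span_sum sign_span.scale singles) auto
    define c where "c = (\<Sum>b\<in>?T. ?c b)"
    have "0 < c" unfolding c_def using T by (intro sum_pos) auto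
    have "sign_span n ?G (\<lambda>x. (1 / c) * ((\<Sum>b\<in>?T. ?c b * ?unit b x)
       + (\<Sum>b\<in>?T. ?c b * (?unit a x - ?unit b x))))"
      by (intro sign_span.scale sign_span.add A B)
    moreover have "(1 / c) * ((\<Sum>b\<in>?T. ?c b * ?unit b x)
       + (\<Sum>b\<in>?T. ?c b * (?unit a x - ?unit b x))) = ?unit a x" for x
      unfolding sum.distrib[symmetric] using \<open>0 < c\<close>
      by (simp add: right_diff_distrib sum_distrib_right[symmetric] c_def[symmetric])
    ultimately show ?thesis by simp
  qed
  \<comment> \<open>The trivial character of a block is not orthogonal to the constants, so it comes from \<open>balance\<close>.\<close>
  have block: "sign_span n ?G (?block i)" if i: "i < q" for i
  proof -
    have "sign_span n ?G (\<lambda>x. (\<Sum>a\<in>{q * ?N..<(q + 1) * ?N}. ?unit a x) + (-1) * (?block q x - ?block i x))"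
      using n i by (intro sign_span.add sign_span.scale sign_span_sum balance single) auto
    moreover have "(\<Sum>a\<in>{q * ?N..<(q + 1) * ?N}. ?unit a x) = ?block q x" for x
    proof -
      have "x div ?N = q \<longleftrightarrow> q * ?N \<le> x \<and> x < (q + 1) * ?N"
        by (metis Suc_eq_plus1 div_less_iff_less_mult le_less_Suc_eq less_eq_div_iff_mult_less_eq less_or_eq_imp_le order.refl pos2 zero_less_power less_Suc_eq_le)
      then show ?thesis by simp
    qed
    ultimately show ?thesis by simp
  qed
  have "sign_span n ?G (?unit a)" if a: "a < n" for a
  proof (cases "q * ?N \<le> a")
    case True
    then show ?thesis using a by (rule single)
  next
    case False
    define i where "i = a div ?N"
    have i: "i < q" using False by (simp add: i_def div_less_iff_less_mult)
    let ?P = "\<lambda>g. sign_span n ?G (\<lambda>x. if x div ?N = i then g (x mod ?N) else 0)"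
    have "\<exists>g. ?P g \<and> (\<forall>x<2 ^ d. g x = (if x = a mod ?N then 1 else 0))"
    proof (rule characters_span)
      show "?P (\<lambda>x. f x + g x)" if "?P f" "?P g" for f g
      proof -
        have "(\<lambda>x. if x div ?N = i then f (x mod ?N) + g (x mod ?N) else 0)
          = (\<lambda>x. (if x div ?N = i then f (x mod ?N) else 0) + (if x div ?N = i then g (x mod ?N) else 0))"
          by auto
        then show ?thesis using sign_span.add[OF that] by simp
      qed
      show "?P (\<lambda>x. c * f x)" if "?P f" for c f
      proof -
        have "(\<lambda>x. if x div ?N = i then c * f (x mod ?N) else 0)
          = (\<lambda>x. c * (if x div ?N = i then f (x mod ?N) else 0))" by auto
        then show ?thesis using sign_span.scale[OF that, of c] by simp
      qed
      show "?P \<chi>" if \<chi>: "character d \<chi>" for \<chi>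
      proof (cases "\<exists>a<2 ^ d. \<chi> a = -1")
        case True
        then show ?thesis using block_character_span[OF qn(1) i \<chi>] by blast
      next
        case False
        then have "\<chi> (x mod ?N) = 1" for x using \<chi> by (auto simp: character_def)
        then show ?thesis using block[OF i] by (simp cong: if_cong)
      qed
    qed simp
    then obtain g where g: "?P g" "\<And>x. x < 2 ^ d \<Longrightarrow> g x = (if x = a mod ?N then 1 else 0)" by blast
    have "(if x div ?N = i then g (x mod ?N) else 0) = ?unit a x" for x
      using g(2)[of "x mod ?N"] by (auto simp: i_def) (metis div_mult_mod_eq)
    with g(1) show ?thesis by simp
  qed
  then show ?thesis by (intro sign_diagonalizableI) (auto simp: block_cograph_def)
qed

section \<open>Isomorphism classes of Cayley graphs\<close>

definition cayley_iso :: "nat \<Rightarrow> nat set \<Rightarrow> nat set \<Rightarrow> bool" where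
  "cayley_iso d S S' \<longleftrightarrow> (\<exists>\<phi>. bij_betw \<phi> {..<2 ^ d} {..<2 ^ d} \<and>
     (\<forall>x<2 ^ d. \<forall>y<2 ^ d. x XOR y \<in> S \<longleftrightarrow> \<phi> x XOR \<phi> y \<in> S'))"

lemma cayley_iso_refl: "cayley_iso d S S"
  unfolding cayley_iso_def by (intro exI[of _ id]) auto

lemma cayley_iso_sym:
  assumes "cayley_iso d S S'"
  shows "cayley_iso d S' S"
proof -
  let ?V = "{..<2 ^ d} :: nat set"
  obtain \<phi> where \<phi>: "bij_betw \<phi> ?V ?V"
    "\<And>x y. x \<in> ?V \<Longrightarrow> y \<in> ?V \<Longrightarrow> x XOR y \<in> S \<longleftrightarrow> \<phi> x XOR \<phi> y \<in> S'"
    using assms unfolding cayley_iso_def by auto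
  let ?\<psi> = "inv_into ?V \<phi>"
  have "?\<psi> x \<in> ?V" "\<phi> (?\<psi> x) = x" if "x \<in> ?V" for x
    using bij_betw_inv_into[OF \<phi>(1)] bij_betw_inv_into_right[OF \<phi>(1)] that
    by (auto simp: bij_betw_def)
  then have "x XOR y \<in> S' \<longleftrightarrow> ?\<psi> x XOR ?\<psi> y \<in> S" if "x \<in> ?V" "y \<in> ?V" for x y
    using \<phi>(2)[of "?\<psi> x" "?\<psi> y"] that by simp
  then show ?thesis unfolding cayley_iso_def
    by (intro exI[of _ ?\<psi>]) (simp add: bij_betw_inv_into[OF \<phi>(1)])
qed

text \<open>
  Every vertex is determined by its adjacencies to the vertices below \<open>b\<close>; such a graph has few
  automorphisms.
\<close>

definition separated :: "nat \<Rightarrow> nat \<Rightarrow> nat set \<Rightarrow> bool" where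
  "separated d b S \<longleftrightarrow> (\<forall>x<2 ^ d. \<forall>y<2 ^ d. (\<forall>v<b. x XOR v \<in> S \<longleftrightarrow> y XOR v \<in> S) \<longrightarrow> x = y)"

text \<open>
  Automorphisms carry the separating vertices to separating vertices, so the image of \<open>x\<close> is
  determined by its adjacencies to the images of the vertices below \<open>b\<close>.
\<close>

lemma separated_automorphisms_eq:
  assumes S: "separated d b S" and b: "b \<le> 2 ^ d"
    and f: "bij_betw f {..<2 ^ d} {..<2 ^ d}"
      "\<And>x y. x < 2 ^ d \<Longrightarrow> y < 2 ^ d \<Longrightarrow> x XOR y \<in> S \<longleftrightarrow> f x XOR f y \<in> S"
    and g: "bij_betw g {..<2 ^ d} {..<2 ^ d}"
      "\<And>x y. x < 2 ^ d \<Longrightarrow> y < 2 ^ d \<Longrightarrow> x XOR y \<in> S \<longleftrightarrow> g x XOR g y \<in> S"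
    and eq: "\<And>v. v < b \<Longrightarrow> f v = g v" and x: "x < 2 ^ d"
  shows "f x = g x"
proof -
  have "g x \<in> f ` {..<2 ^ d}" using f(1) g(1) x by (auto simp: bij_betw_def)
  then obtain u where u: "u < 2 ^ d" "g x = f u" by auto
  have "x XOR v \<in> S \<longleftrightarrow> u XOR v \<in> S" if v: "v < b" for v
  proof -
    have v': "v < 2 ^ d" using v b by simp
    have "x XOR v \<in> S \<longleftrightarrow> f u XOR f v \<in> S" using g(2)[OF x v'] u(2) eq[OF v] by simp
    also have "\<dots> \<longleftrightarrow> u XOR v \<in> S" using f(2)[OF u(1) v'] by simp
    finally show ?thesis .
  qed
  then have "x = u" using S x u(1) unfolding separated_def by blast
  with u(2) show ?thesis by simp
qed

text \<open>
  Let \<open>\<phi>\<close> be an isomorphism to the Cayley graph of \<open>S'\<close>, with inverse \<open>\<psi>\<close>.  Pulling back the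
  translation by \<open>2 ^ k\<close> gives an automorphism \<open>\<sigma> k\<close> of the Cayley graph of \<open>S\<close>, which is determined by
  its values at the vertices below \<open>b\<close>.  All \<open>\<sigma> k\<close> and \<open>\<psi> 0\<close> together determine \<open>\<psi>\<close> by following
  generators, and \<open>\<psi>\<close> determines \<open>S'\<close>.  So \<open>S'\<close> is encoded by \<open>d * b + 1\<close> vertices.
\<close>

lemma card_cayley_iso_le:
  assumes S: "separated d b S" and b: "b \<le> 2 ^ d"
  shows "card {S'. S' \<subseteq> {..<2 ^ d} \<and> cayley_iso d S S'} \<le> (2 ^ d) ^ (d * b + 1)"
proof -
  let ?V = "{..<2 ^ d} :: nat set" and ?A = "{S'. S' \<subseteq> {..<2 ^ d} \<and> cayley_iso d S S'}"
  have "\<forall>S'\<in>?A. \<exists>\<phi>. bij_betw \<phi> ?V ?V \<and> (\<forall>x\<in>?V. \<forall>y\<in>?V. x XOR y \<in> S \<longleftrightarrow> \<phi> x XOR \<phi> y \<in> S')"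
    unfolding cayley_iso_def by auto
  from bchoice[OF this] obtain \<phi> where "\<forall>S'\<in>?A. bij_betw (\<phi> S') ?V ?V \<and>
      (\<forall>x\<in>?V. \<forall>y\<in>?V. x XOR y \<in> S \<longleftrightarrow> \<phi> S' x XOR \<phi> S' y \<in> S')" ..
  then have bij: "\<And>S'. S' \<in> ?A \<Longrightarrow> bij_betw (\<phi> S') ?V ?V"
    and iso: "\<And>S' x y. S' \<in> ?A \<Longrightarrow> x \<in> ?V \<Longrightarrow> y \<in> ?V \<Longrightarrow> x XOR y \<in> S \<longleftrightarrow> \<phi> S' x XOR \<phi> S' y \<in> S'"
    by blast+
  define \<psi> where "\<psi> S' = inv_into ?V (\<phi> S')" for S'
  have \<psi>_bij: "bij_betw (\<psi> S') ?V ?V" if "S' \<in> ?A" for S'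
    unfolding \<psi>_def using bij[OF that] by (rule bij_betw_inv_into)
  have \<psi>_V: "\<psi> S' x \<in> ?V" if "S' \<in> ?A" "x \<in> ?V" for S' x
    using \<psi>_bij[OF that(1)] that(2) by (auto simp: bij_betw_def)
  have \<phi>_V: "\<phi> S' x \<in> ?V" if "S' \<in> ?A" "x \<in> ?V" for S' x
    using bij[OF that(1)] that(2) by (auto simp: bij_betw_def)
  have \<phi>\<psi>: "\<phi> S' (\<psi> S' x) = x" if "S' \<in> ?A" "x \<in> ?V" for S' x
    unfolding \<psi>_def using bij[OF that(1)] that(2) by (simp add: bij_betw_inv_into_right)
  have \<psi>\<phi>: "\<psi> S' (\<phi> S' x) = x" if "S' \<in> ?A" "x \<in> ?V" for S' x
    unfolding \<psi>_def using bij[OF that(1)] that(2) by (simp add: bij_betw_inv_into_left)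
  have pow_V: "2 ^ k \<in> ?V" if "k < d" for k using that by simp
  have xor_V: "x XOR y \<in> ?V" if "x \<in> ?V" "y \<in> ?V" for x y
    using that by (simp add: xor_less_two_power)
  define \<sigma> where "\<sigma> S' k = (\<lambda>x. \<psi> S' (2 ^ k XOR \<phi> S' x))" for S' k
  have \<sigma>_bij: "bij_betw (\<sigma> S' k) ?V ?V" if "S' \<in> ?A" "k < d" for S' k
  proof -
    have "bij_betw (\<psi> S' \<circ> (\<lambda>x. 2 ^ k XOR x) \<circ> \<phi> S') ?V ?V"
      using bij[OF that(1)] bij_betw_xor \<psi>_bij[OF that(1)] pow_V[OF that(2)]
      by (meson bij_betw_trans lessThan_iff)
    then show ?thesis by (simp add: \<sigma>_def comp_def)
  qed
  have \<sigma>_aut: "x XOR y \<in> S \<longleftrightarrow> \<sigma> S' k x XOR \<sigma> S' k y \<in> S"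
    if "S' \<in> ?A" "k < d" "x < 2 ^ d" "y < 2 ^ d" for S' k x y
  proof -
    have V: "2 ^ k XOR \<phi> S' z \<in> ?V" if "z \<in> ?V" for z
      using \<phi>_V xor_V pow_V \<open>S' \<in> ?A\<close> \<open>k < d\<close> that by blast
    have "\<sigma> S' k x XOR \<sigma> S' k y \<in> S \<longleftrightarrow> (2 ^ k XOR \<phi> S' x) XOR (2 ^ k XOR \<phi> S' y) \<in> S'"
    proof -
      have "x \<in> ?V" "y \<in> ?V" using that by auto
      note V' = V[OF this(1)] V[OF this(2)]
      show ?thesis
        using iso[OF that(1) \<psi>_V[OF that(1) V'(1)] \<psi>_V[OF that(1) V'(2)]]
        unfolding \<sigma>_def \<phi>\<psi>[OF that(1) V'(1)] \<phi>\<psi>[OF that(1) V'(2)] .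
    qed
    also have "(2 ^ k XOR \<phi> S' x) XOR (2 ^ k XOR \<phi> S' y) = \<phi> S' x XOR \<phi> S' y"
      by (metis xor.assoc xor.commute xor_cancel_left)
    also have "\<dots> \<in> S' \<longleftrightarrow> x XOR y \<in> S" using iso that by simp
    finally show ?thesis by simp
  qed
  define code where
    "code S' = (\<psi> S' 0, restrict (\<lambda>(k, v). \<sigma> S' k v) ({..<d} \<times> {..<b}))" for S'
  let ?C = "?V \<times> (({..<d} \<times> {..<b}) \<rightarrow>\<^sub>E ?V)"
  have "inj_on code ?A"
  proof (rule inj_onI)
    fix S1 S2 assume A: "S1 \<in> ?A" "S2 \<in> ?A" and eq: "code S1 = code S2"
    have \<psi>0: "\<psi> S1 0 = \<psi> S2 0" using eq by (simp add: code_def)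
    have "\<sigma> S1 k v = \<sigma> S2 k v" if "k < d" "v < b" for k v
    proof -
      have "restrict (\<lambda>(k, v). \<sigma> S1 k v) ({..<d} \<times> {..<b}) (k, v)
          = restrict (\<lambda>(k, v). \<sigma> S2 k v) ({..<d} \<times> {..<b}) (k, v)"
        using eq by (simp add: code_def)
      then show ?thesis using that by simp
    qed
    then have \<sigma>: "\<sigma> S1 k x = \<sigma> S2 k x" if "k < d" "x < 2 ^ d" for k x
      using separated_automorphisms_eq[OF S b \<sigma>_bij[OF A(1) that(1)] \<sigma>_aut[OF A(1) that(1)]
          \<sigma>_bij[OF A(2) that(1)] \<sigma>_aut[OF A(2) that(1)]] that by blast
    have \<psi>: "\<psi> S1 z = \<psi> S2 z" if "z < 2 ^ d" for z
      using that
    proof (induction rule: xor_induct)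
      case (flip x k)
      have "\<psi> S' (x XOR 2 ^ k) = \<sigma> S' k (\<psi> S' x)" if "S' \<in> ?A" for S'
        using \<phi>\<psi>[OF that, of x] flip by (simp add: \<sigma>_def xor.commute)
      then show ?case using A flip \<sigma>[OF flip(2)] \<psi>_V by simp
    qed (rule \<psi>0)
    have "z \<in> S' \<longleftrightarrow> \<psi> S' z XOR \<psi> S' 0 \<in> S" if "S' \<in> ?A" "z < 2 ^ d" for z S'
      using iso[OF that(1), of "\<psi> S' z" "\<psi> S' 0"] \<psi>_V[OF that(1)] \<phi>\<psi>[OF that(1)] that(2) by simp
    then have "z \<in> S1 \<longleftrightarrow> z \<in> S2" if "z < 2 ^ d" for z
      using A \<psi> that by simp
    moreover have "S1 \<subseteq> ?V" "S2 \<subseteq> ?V" using A by auto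
    ultimately show "S1 = S2" by blast
  qed
  moreover have "code ` ?A \<subseteq> ?C"
  proof -
    have "\<sigma> S' k v \<in> ?V" if "S' \<in> ?A" "k < d" "v < b" for S' k v
      using \<sigma>_bij[OF that(1,2)] that(3) b by (auto simp: bij_betw_def)
    then show ?thesis using \<psi>_V unfolding code_def by (auto split: if_splits)
  qed
  moreover have "finite ?C" by (intro finite_cartesian_product finite_PiE) auto
  ultimately have "card ?A \<le> card ?C" by (rule card_inj_on_le)
  also have "\<dots> = 2 ^ d * (2 ^ d) ^ (d * b)"
    by (simp add: card_cartesian_product card_funcsetE)
  finally show ?thesis by simp
qed

text \<open>
  If no vertex below \<open>2 * m\<close> tells \<open>x\<close> and \<open>y\<close> apart, then \<open>S\<close> is invariant under translation by
  \<open>c = x XOR y\<close> at the \<open>2 * m\<close> elements \<open>x XOR v\<close>.  These meet at least \<open>m\<close> cosets of \<open>{0, c}\<close>, and in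
  each of them one element of \<open>S\<close> is dictated by the other.
\<close>

lemma card_confused_le:
  assumes x: "x < 2 ^ d" and y: "y < 2 ^ d" and xy: "x \<noteq> y" and m: "2 * m \<le> 2 ^ d"
  shows "card {S. S \<subseteq> {..<2 ^ d} \<and> (\<forall>v<2 * m. x XOR v \<in> S \<longleftrightarrow> y XOR v \<in> S)} \<le> 2 ^ (2 ^ d - m)"
proof -
  let ?V = "{..<2 ^ d} :: nat set"
  let ?A = "{S. S \<subseteq> ?V \<and> (\<forall>v<2 * m. x XOR v \<in> S \<longleftrightarrow> y XOR v \<in> S)}"
  define c where "c = x XOR y"
  have c: "c < 2 ^ d" using x y by (simp add: c_def xor_less_two_power)
  have "c \<noteq> 0" using xy by (simp add: c_def xor_eq_zero_iff)
  then obtain i where i: "bit c i" by (metis bit_0_eq bit_eqI bot_apply bot_bool_def)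
  define U where "U = (\<lambda>v. x XOR v) ` {..<2 * m}"
  have cardU: "card U = 2 * m"
  proof -
    have "inj_on (\<lambda>v. x XOR v) {..<2 * m}" by (rule inj_onI) (metis xor_cancel_left)
    then show ?thesis by (simp add: U_def card_image)
  qed
  have UV: "U \<subseteq> ?V" using x m by (auto simp: U_def xor_less_two_power)
  \<comment> \<open>Translation by \<open>c\<close> flips bit \<open>i\<close>, so \<open>W\<close> has exactly one element in each coset that meets \<open>U\<close>.\<close>
  define W where "W = {u \<in> U \<union> (\<lambda>u. c XOR u) ` U. \<not> bit u i}"
  have finW: "finite W" by (simp add: W_def U_def)
  have WV: "W \<subseteq> ?V" using UV c by (auto simp: W_def xor_less_two_power)
  have "U \<subseteq> W \<union> (\<lambda>u. c XOR u) ` W"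
  proof
    fix u assume u: "u \<in> U"
    have "u = c XOR (c XOR u)" by (simp add: xor_cancel_left)
    moreover have "bit u i \<Longrightarrow> c XOR u \<in> W" "\<not> bit u i \<Longrightarrow> u \<in> W"
      using u i by (auto simp: W_def bit_xor_iff)
    ultimately show "u \<in> W \<union> (\<lambda>u. c XOR u) ` W" by blast
  qed
  then have "card U \<le> card (W \<union> (\<lambda>u. c XOR u) ` W)" using finW by (intro card_mono) auto
  also have "\<dots> \<le> card W + card W"
    by (rule order_trans[OF card_Un_le]) (simp add: card_image_le finW)
  finally have mW: "m \<le> card W" using cardU by simp
  have swap: "w \<in> S \<longleftrightarrow> c XOR w \<in> S" if S: "S \<in> ?A" and w: "w \<in> W" for S w
  proof -
    have *: "u \<in> S \<longleftrightarrow> c XOR u \<in> S" if u: "u \<in> U" for u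
    proof -
      obtain v where v: "v < 2 * m" "u = x XOR v" using u by (auto simp: U_def)
      have "c XOR u = y XOR v"
        unfolding c_def v(2) by (simp only: xor.assoc xor.left_commute[of y x] xor_cancel_left)
      with S v show ?thesis by auto
    qed
    from w consider "w \<in> U" | u where "u \<in> U" "w = c XOR u" by (auto simp: W_def)
    then show ?thesis
    proof cases
      case 1
      then show ?thesis by (rule *)
    next
      case 2
      then show ?thesis using *[OF 2(1)] by (simp only: 2(2) xor_cancel_left)
    qed
  qed
  have "inj_on (\<lambda>S. S - W) ?A"
  proof (rule inj_onI)
    fix S1 S2 assume A: "S1 \<in> ?A" "S2 \<in> ?A" and eq: "S1 - W = S2 - W"
    have "w \<in> S1 \<longleftrightarrow> w \<in> S2" if w: "w \<in> W" for w
    proof -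
      have "c XOR w \<notin> W" using w i by (auto simp: W_def bit_xor_iff)
      then have "c XOR w \<in> S1 \<longleftrightarrow> c XOR w \<in> S2" using eq by blast
      then show ?thesis using swap A w by blast
    qed
    with eq show "S1 = S2" by blast
  qed
  then have "card ?A \<le> card (Pow (?V - W))"
    by (rule card_inj_on_le) auto
  also have "\<dots> = 2 ^ (2 ^ d - card W)"
    using WV finW by (simp add: card_Pow card_Diff_subset)
  also have "\<dots> \<le> 2 ^ (2 ^ d - m)" using mW by (intro power_increasing) auto
  finally show ?thesis .
qed

text \<open>
  Excluding \<open>0\<close> makes the Cayley graph loopless, and the generators \<open>2 ^ k\<close> make it connected.
\<close>

definition good_sets :: "nat \<Rightarrow> nat \<Rightarrow> nat set set" where
  "good_sets d b = {S. S \<subseteq> {0<..<2 ^ d} \<and> (\<forall>k<d. 2 ^ k \<in> S) \<and> separated d b S}"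

text \<open>
  There are \<open>2 ^ (N - 1 - d)\<close> sets that contain all generators and not \<open>0\<close>, where \<open>N = 2 ^ d\<close>.  Each of
  the fewer than \<open>2 ^ (2 * d)\<close> pairs of vertices spoils at most \<open>2 ^ (N - (3 * d + 2))\<close> of them.  The
  constant \<open>6 * d + 4\<close> makes the total loss at most half.
\<close>

lemma card_good_sets_ge:
  assumes d: "6 * d + 4 \<le> 2 ^ d"
  shows "2 ^ (2 ^ d - 2 - d) \<le> card (good_sets d (6 * d + 4))"
proof -
  let ?V = "{..<2 ^ d} :: nat set" and ?m = "3 * d + 2"
  let ?E = "(\<lambda>k. 2 ^ k) ` {..<d} :: nat set"
  let ?F = "{0<..<2 ^ d} - ?E"
  let ?bad = "\<lambda>x y. {S. S \<subseteq> ?V \<and> (\<forall>v<2 * ?m. x XOR v \<in> S \<longleftrightarrow> y XOR v \<in> S)}"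
  let ?P = "{p \<in> ?V \<times> ?V. fst p \<noteq> snd p}"
  let ?B = "\<Union>p\<in>?P. ?bad (fst p) (snd p)"
  have E: "?E \<subseteq> {0<..<2 ^ d}" by auto
  have "card ?E = d" by (simp add: card_image inj_on_def)
  then have cF: "card ?F = 2 ^ d - 1 - d" using E by (simp add: card_Diff_subset)
  have "card ((\<lambda>T. ?E \<union> T) ` Pow ?F) = 2 ^ (2 ^ d - 1 - d)"
  proof -
    have "inj_on (\<lambda>T. ?E \<union> T) (Pow ?F)" by (rule inj_onI) blast
    then show ?thesis by (simp only: card_image card_Pow finite_Diff finite_greaterThanLessThan cF)
  qed
  moreover have sub: "(\<lambda>T. ?E \<union> T) ` Pow ?F \<subseteq> good_sets d (6 * d + 4) \<union> ?B"
  proof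
    fix S assume "S \<in> (\<lambda>T. ?E \<union> T) ` Pow ?F"
    then have S: "S \<subseteq> {0<..<2 ^ d}" "\<forall>k<d. 2 ^ k \<in> S" using E by auto
    show "S \<in> good_sets d (6 * d + 4) \<union> ?B"
    proof (cases "separated d (2 * ?m) S")
      case True
      moreover have "2 * ?m = 6 * d + 4" by simp
      ultimately have "separated d (6 * d + 4) S" by (simp only:)
      then show ?thesis using S by (simp add: good_sets_def)
    next
      case False
      then obtain x y where "x < 2 ^ d" "y < 2 ^ d" "x \<noteq> y" "\<forall>v<2 * ?m. x XOR v \<in> S \<longleftrightarrow> y XOR v \<in> S"
        unfolding separated_def by blast
      moreover from this have "(x, y) \<in> ?P" by simp
      moreover have "S \<subseteq> ?V" using S by auto
      ultimately have "\<exists>p\<in>?P. S \<in> ?bad (fst p) (snd p)" by (intro bexI[of _ "(x, y)"]) simp_all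
      then show ?thesis by blast
    qed
  qed
  moreover have "good_sets d (6 * d + 4) \<subseteq> Pow ?V" "?B \<subseteq> Pow ?V" by (auto simp: good_sets_def)
  then have "finite (good_sets d (6 * d + 4) \<union> ?B)"
    by (intro finite_subset[OF Un_least finite_Pow_iff[THEN iffD2, OF finite_lessThan]])
  note card_mono[OF this sub]
  ultimately have "2 ^ (2 ^ d - 1 - d) \<le> card (good_sets d (6 * d + 4) \<union> ?B)" by (simp only:)
  also have "\<dots> \<le> card (good_sets d (6 * d + 4)) + card ?B" by (rule card_Un_le)
  finally have 1: "2 ^ (2 ^ d - 1 - d) \<le> card (good_sets d (6 * d + 4)) + card ?B" .
  have "card ?B \<le> (\<Sum>p\<in>?P. card (?bad (fst p) (snd p)))" by (rule card_UN_le) auto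
  also have "\<dots> \<le> (\<Sum>p\<in>?P. 2 ^ (2 ^ d - ?m))"
  proof (rule sum_mono)
    fix p assume "p \<in> ?P"
    then show "card (?bad (fst p) (snd p)) \<le> 2 ^ (2 ^ d - ?m)"
      using d by (intro card_confused_le) auto
  qed
  also have "\<dots> \<le> card (?V \<times> ?V) * 2 ^ (2 ^ d - ?m)"
  proof -
    have "card ?P \<le> card (?V \<times> ?V)" by (intro card_mono) auto
    then show ?thesis by (simp only: sum_constant of_nat_id mult_right_mono)
  qed
  also have "\<dots> = 2 ^ (d + d + (2 ^ d - ?m))"
    by (simp only: card_cartesian_product card_lessThan power_add)
  also have "d + d + (2 ^ d - ?m) = 2 ^ d - 2 - d" using d by linarith
  finally have 2: "card ?B \<le> 2 ^ (2 ^ d - 2 - d)" .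
  have "2 ^ d - 1 - d = Suc (2 ^ d - 2 - d)" using d by linarith
  then have "2 ^ (2 ^ d - 1 - d) = 2 * (2 ^ (2 ^ d - 2 - d) :: nat)" by (simp only: power_Suc)
  with 1 2 show ?thesis by linarith
qed

text \<open>
  A maximal set of pairwise non-isomorphic members meets every isomorphism class, and the classes
  are small.
\<close>

lemma exists_cayley_transversal:
  assumes d: "6 * d + 4 \<le> 2 ^ d"
  obtains R where "R \<subseteq> good_sets d (6 * d + 4)"
    "\<forall>S\<in>R. \<forall>S'\<in>R. cayley_iso d S S' \<longrightarrow> S = S'"
    "2 ^ (2 ^ d - 2 - d) \<le> card R * (2 ^ d) ^ (d * (6 * d + 4) + 1)"
proof -
  let ?A = "good_sets d (6 * d + 4)"
  define indep where
    "indep R \<longleftrightarrow> R \<subseteq> ?A \<and> (\<forall>S\<in>R. \<forall>S'\<in>R. cayley_iso d S S' \<longrightarrow> S = S')" for R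
  have A: "?A \<subseteq> Pow {..<2 ^ d}" by (auto simp: good_sets_def)
  then have finA: "finite ?A" by (rule finite_subset) simp
  have "Collect indep \<subseteq> Pow ?A" by (auto simp: indep_def)
  then have "finite (Collect indep)" by (rule finite_subset) (simp add: finA)
  moreover have "indep {}" by (simp add: indep_def)
  then have "Collect indep \<noteq> {}" by blast
  ultimately obtain R where R: "indep R" and max: "\<And>R'. indep R' \<Longrightarrow> R \<subseteq> R' \<Longrightarrow> R = R'"
    using finite_has_maximal[of "Collect indep"] by (metis mem_Collect_eq)
  have RA: "R \<subseteq> ?A" using R by (simp add: indep_def)
  have free: "S = S'" if "S \<in> R" "S' \<in> R" "cayley_iso d S S'" for S S'
    using R that unfolding indep_def by blast
  have finR: "finite R" using RA finA by (rule finite_subset)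
  let ?orbit = "\<lambda>S'. {S. S \<subseteq> {..<2 ^ d} \<and> cayley_iso d S' S}"
  have "\<exists>S'\<in>R. cayley_iso d S' S" if S: "S \<in> ?A" for S
  proof (cases "S \<in> R")
    case True
    then show ?thesis by (intro bexI[of _ S] cayley_iso_refl)
  next
    case False
    then have "\<not> indep (insert S R)" using max[of "insert S R"] by blast
    moreover have "insert S R \<subseteq> ?A" using S RA by simp
    ultimately obtain S1 S2 where S12: "S1 \<in> insert S R" "S2 \<in> insert S R" "cayley_iso d S1 S2" "S1 \<noteq> S2"
      unfolding indep_def by blast
    then have "(S1 = S \<and> S2 \<in> R) \<or> (S2 = S \<and> S1 \<in> R)" using free[of S1 S2] by (elim insertE) simp_all
    then show ?thesis
    proof (elim disjE conjE)
      assume "S1 = S" "S2 \<in> R"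
      then show ?thesis using cayley_iso_sym[OF S12(3)] by (intro bexI[of _ S2]) simp_all
    next
      assume "S2 = S" "S1 \<in> R"
      then show ?thesis using S12(3) by (intro bexI[of _ S1]) simp_all
    qed
  qed
  then have "?A \<subseteq> (\<Union>S'\<in>R. ?orbit S')" using A by fast
  moreover have "finite (\<Union>S'\<in>R. ?orbit S')" using finR by simp
  ultimately have "card ?A \<le> card (\<Union>S'\<in>R. ?orbit S')" by (intro card_mono)
  also have "\<dots> \<le> (\<Sum>S'\<in>R. card (?orbit S'))" using finR by (rule card_UN_le)
  also have "\<dots> \<le> (\<Sum>S'\<in>R. (2 ^ d) ^ (d * (6 * d + 4) + 1))"
  proof (rule sum_mono)
    fix S assume "S \<in> R"
    then have "separated d (6 * d + 4) S" using RA by (auto simp: good_sets_def)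
    then show "card (?orbit S) \<le> (2 ^ d) ^ (d * (6 * d + 4) + 1)" using d by (rule card_cayley_iso_le)
  qed
  also have "\<dots> = card R * (2 ^ d) ^ (d * (6 * d + 4) + 1)" by (simp only: sum_constant of_nat_id)
  finally have "2 ^ (2 ^ d - 2 - d) \<le> card R * (2 ^ d) ^ (d * (6 * d + 4) + 1)"
    using card_good_sets_ge[OF d] by (rule order_trans[rotated])
  with RA R[unfolded indep_def, THEN conjunct2] show ?thesis by (rule that)
qed

section \<open>From Cayley graphs to connected graphs\<close>

lemma connected_if_universal_vertex:
  assumes G: "pair_graph G" and a: "a \<in> pverts G"
    and arc: "\<And>x. x \<in> pverts G \<Longrightarrow> x \<noteq> a \<Longrightarrow> (a, x) \<in> parcs G"
  shows "Digraph_Component.connected (with_proj G)"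
proof -
  interpret pair_graph G by (rule G)
  have 1: "a \<rightarrow>\<^sup>*\<^bsub>with_proj G\<^esub> x" if "x \<in> pverts G" for x
    using arc[OF that] that by (cases "x = a") auto
  have 2: "x \<rightarrow>\<^sup>*\<^bsub>with_proj G\<^esub> a" if "x \<in> pverts G" for x
    using symmetric_reachable[OF pair_sym_arcs 1[OF that]] .
  have "x \<rightarrow>\<^sup>*\<^bsub>with_proj G\<^esub> y" if "x \<in> pverts G" "y \<in> pverts G" for x y
    using reachable_trans[OF 2[OF that(1)] 1[OF that(2)]] .
  then show ?thesis
    unfolding connected_def strongly_connected_def
    using a by (simp only: reachable_mk_symmetric_eq[OF pair_sym_arcs] pverts_mk_symmetric with_proj_simps) blast
qed

text \<open>
  An isolated vertex of the union is adjacent to all others in the complement.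
\<close>

lemma block_cograph_in_conn_sign_diag_graphs:
  assumes n: "(q + 1) * 2 ^ d \<le> n" and q: "0 < q"
  shows "block_cograph n d q S \<in> conn_sign_diag_graphs n"
proof -
  let ?G = "block_cograph n d q S"
  have fin: "finite (parcs ?G)"
    by (rule finite_subset[of _ "{..<n} \<times> {..<n}"]) (auto simp: block_cograph_def)
  have G: "pair_graph ?G"
  proof unfold_locales
    show "symmetric (with_proj ?G)"
      unfolding symmetric_def with_proj_simps by (rule symI) (auto simp: block_cograph_def block_adj_sym)
  qed (use fin in \<open>auto simp: block_cograph_def\<close>)
  define a where "a = q * 2 ^ d"
  have "a div 2 ^ d = q" by (simp add: a_def)
  then have "\<not> block_adj d q S a x" for x by (auto simp: block_adj_def)
  moreover have "a < n"
  proof -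
    have "a < (q + 1) * 2 ^ d" by (simp add: a_def)
    with n show ?thesis by linarith
  qed
  ultimately have "Digraph_Component.connected (with_proj ?G)"
    by (intro connected_if_universal_vertex[OF G, of a]) (auto simp: block_cograph_def)
  with G block_cograph_sign_diagonalizable[OF n q] show ?thesis
    by (simp add: conn_sign_diag_graphs_def block_cograph_def)
qed

lemma digraph_iso_with_projE:
  assumes "digraph_iso (with_proj G) (with_proj H)"
  obtains \<phi> where "bij_betw \<phi> (pverts G) (pverts H)"
    "\<And>x y. x \<in> pverts G \<Longrightarrow> y \<in> pverts G \<Longrightarrow> (x, y) \<in> parcs G \<longleftrightarrow> (\<phi> x, \<phi> y) \<in> parcs H"
proof -
  obtain f where f: "pre_digraph.digraph_isomorphism (with_proj G) f" "with_proj H = app_iso f (with_proj G)"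
    using assms unfolding digraph_iso_def by blast
  let ?\<phi> = "iso_verts f"
  have H: "pverts H = ?\<phi> ` pverts G" "parcs H = iso_arcs f ` parcs G" "iso_tail f = fst" "iso_head f = snd"
    using f(2) unfolding app_iso_def with_proj_def by simp_all
  have inj: "inj_on ?\<phi> (pverts G)"
    and wf: "wf_digraph (with_proj G)"
    and arcs: "\<And>e. e \<in> parcs G \<Longrightarrow> iso_arcs f e = (?\<phi> (fst e), ?\<phi> (snd e))"
    using f(1) unfolding pre_digraph.digraph_isomorphism_def by (auto simp: H prod_eq_iff)
  have verts: "fst e \<in> pverts G" "snd e \<in> pverts G" if "e \<in> parcs G" for e
    using wf_digraph.tail_in_verts[OF wf, of e] wf_digraph.head_in_verts[OF wf, of e] that by simp_all
  have "bij_betw ?\<phi> (pverts G) (pverts H)" using inj H(1) by (simp add: bij_betw_def)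
  moreover have "(x, y) \<in> parcs G \<longleftrightarrow> (?\<phi> x, ?\<phi> y) \<in> parcs H" if xy: "x \<in> pverts G" "y \<in> pverts G" for x y
  proof
    assume "(x, y) \<in> parcs G"
    then show "(?\<phi> x, ?\<phi> y) \<in> parcs H" using arcs[of "(x, y)"] H(2) by force
  next
    assume "(?\<phi> x, ?\<phi> y) \<in> parcs H"
    then obtain e where e: "e \<in> parcs G" "(?\<phi> x, ?\<phi> y) = (?\<phi> (fst e), ?\<phi> (snd e))" using H(2) arcs by force
    then have "x = fst e" "y = snd e" using inj_onD[OF inj] xy verts by auto
    with e show "(x, y) \<in> parcs G" by simp
  qed
  ultimately show ?thesis using that by blast
qed

lemma digraph_iso_refl:
  assumes "pair_graph G"
  shows "digraph_iso (with_proj G) (with_proj G)"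
proof -
  have wf: "wf_digraph (with_proj G)"
  proof -
    interpret pair_graph G by (rule assms)
    show ?thesis by unfold_locales
  qed
  let ?id = "\<lparr>iso_verts = id, iso_arcs = id, iso_head = snd, iso_tail = fst\<rparr>"
  have "pre_digraph.digraph_isomorphism (with_proj G) ?id"
    using wf by (simp add: pre_digraph.digraph_isomorphism_def)
  moreover have "with_proj G = app_iso ?id (with_proj G)" by (simp add: app_iso_def with_proj_def)
  ultimately show ?thesis unfolding digraph_iso_def by blast
qed

text \<open>
  An isomorphism \<open>\<phi>\<close> of the complements is one of the disjoint unions.  Since block \<open>i\<close> is
  connected, \<open>\<phi>\<close> maps it into one block \<open>j\<close>, and onto it as both have \<open>2 ^ d\<close> vertices.  The hypothesis
  \<open>0 < d\<close> ensures that the vertices of block \<open>i\<close> are not isolated, whence \<open>j < q\<close>.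
\<close>

lemma block_cograph_iso_imp_cayley_iso:
  assumes iso: "digraph_iso (with_proj (block_cograph n d q S)) (with_proj (block_cograph n d q S'))"
    and n: "q * 2 ^ d \<le> n" and d: "0 < d" and i: "i < q"
    and S0: "0 \<notin> S i" and Sk: "\<And>k. k < d \<Longrightarrow> 2 ^ k \<in> S i" and S'0: "\<And>j. j < q \<Longrightarrow> 0 \<notin> S' j"
  shows "\<exists>j<q. cayley_iso d (S i) (S' j)"
proof -
  let ?N = "2 ^ d :: nat"
  obtain \<phi> where bij: "bij_betw \<phi> {..<n} {..<n}"
    and arcs: "\<And>x y. x < n \<Longrightarrow> y < n \<Longrightarrow> (x, y) \<in> parcs (block_cograph n d q S)
      \<longleftrightarrow> (\<phi> x, \<phi> y) \<in> parcs (block_cograph n d q S')"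
    using digraph_iso_with_projE[OF iso] by (auto simp: block_cograph_def)
  have \<phi>n: "\<phi> x < n" if "x < n" for x using bij that by (auto simp: bij_betw_def)
  have \<phi>_eq: "\<phi> x = \<phi> y \<longleftrightarrow> x = y" if "x < n" "y < n" for x y
    using bij that by (auto simp: bij_betw_def inj_on_def)
  have adj: "block_adj d q S x y \<longleftrightarrow> block_adj d q S' (\<phi> x) (\<phi> y)" if "x < n" "y < n" "x \<noteq> y" for x y
    using arcs[OF that(1,2)] \<phi>n[OF that(1)] \<phi>n[OF that(2)] \<phi>_eq[OF that(1,2)] that
    by (simp add: block_cograph_def)
  have "(i + 1) * ?N \<le> q * ?N" using i by (intro mult_right_mono) auto
  with n have iN: "i * ?N + w < n" if "w < ?N" for w using that by simp
  have local_adj: "w XOR w' \<in> S i \<longleftrightarrow> block_adj d q S' (\<phi> (i * ?N + w)) (\<phi> (i * ?N + w'))"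
    if w: "w < ?N" "w' < ?N" "w \<noteq> w'" for w w'
    using adj[OF iN[OF w(1)] iN[OF w(2)]] w i by (simp add: block_adj_def)
  define j where "j = \<phi> (i * ?N) div ?N"
  define \<theta> where "\<theta> w = \<phi> (i * ?N + w) mod ?N" for w
  have step: "\<phi> (i * ?N + (w XOR 2 ^ k)) div ?N = \<phi> (i * ?N + w) div ?N" "\<phi> (i * ?N + w) div ?N < q"
    if w: "w < ?N" and k: "k < d" for w k
  proof -
    have k': "2 ^ k < ?N" using k by simp
    have "w XOR (w XOR 2 ^ k) \<in> S i" using Sk[OF k] by (simp add: xor_cancel_left)
    moreover have "w \<noteq> w XOR 2 ^ k"
      by (metis power_not_zero xor.right_neutral xor_cancel_left xor_self_eq zero_neq_numeral)
    ultimately have "block_adj d q S' (\<phi> (i * ?N + w)) (\<phi> (i * ?N + (w XOR 2 ^ k)))"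
      using local_adj[OF w xor_less_two_power[OF w k']] by blast
    then show "\<phi> (i * ?N + (w XOR 2 ^ k)) div ?N = \<phi> (i * ?N + w) div ?N" "\<phi> (i * ?N + w) div ?N < q"
      by (auto simp: block_adj_def)
  qed
  have jq: "j < q" using step(2)[of 0 0] d by (simp add: j_def)
  have j: "\<phi> (i * ?N + w) div ?N = j" if "w < ?N" for w
    using that by (induction rule: xor_induct) (simp_all add: j_def step(1))
  have \<theta>: "\<phi> (i * ?N + w) = j * ?N + \<theta> w" if "w < ?N" for w
    using j[OF that] by (metis \<theta>_def div_mult_mod_eq)
  have "inj_on \<theta> {..<?N}"
  proof (rule inj_onI)
    fix w w' assume w: "w \<in> {..<?N}" "w' \<in> {..<?N}" "\<theta> w = \<theta> w'"
    then have "\<phi> (i * ?N + w) = \<phi> (i * ?N + w')" using \<theta> by simp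
    then show "w = w'" using \<phi>_eq iN w by simp
  qed
  moreover have "\<theta> ` {..<?N} \<subseteq> {..<?N}" by (auto simp: \<theta>_def)
  ultimately have "bij_betw \<theta> {..<?N} {..<?N}"
    by (simp add: bij_betw_def endo_inj_surj)
  moreover have "w XOR w' \<in> S i \<longleftrightarrow> \<theta> w XOR \<theta> w' \<in> S' j" if w: "w < ?N" "w' < ?N" for w w'
  proof (cases "w = w'")
    case True
    then show ?thesis using S0 S'0[OF jq] by simp
  next
    case False
    then show ?thesis using local_adj[OF w False] j[OF w(1)] j[OF w(2)] jq by (simp add: block_adj_def \<theta>_def)
  qed
  ultimately show ?thesis using jq unfolding cayley_iso_def by blast
qed

lemma finite_conn_sign_diag_graphs: "finite (conn_sign_diag_graphs n)"
proof -
  have "conn_sign_diag_graphs n \<subseteq> (\<lambda>E. \<lparr>pverts = {..<n}, parcs = E\<rparr>) ` Pow ({..<n} \<times> {..<n})"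
  proof
    fix G assume G: "G \<in> conn_sign_diag_graphs n"
    then interpret pair_graph G by (simp add: conn_sign_diag_graphs_def)
    have V: "pverts G = {..<n}" using G by (simp add: conn_sign_diag_graphs_def)
    have "parcs G \<subseteq> {..<n} \<times> {..<n}"
      using arc_fst_in_verts arc_snd_in_verts unfolding V by (auto simp: mem_Times_iff)
    then show "G \<in> (\<lambda>E. \<lparr>pverts = {..<n}, parcs = E\<rparr>) ` Pow ({..<n} \<times> {..<n})"
      using V by (intro image_eqI[of _ _ "parcs G"]) simp_all
  qed
  then show ?thesis by (rule finite_subset) simp
qed

lemma card_pairwise_nonisomorphic_le_cs:
  assumes F: "\<And>a. a \<in> A \<Longrightarrow> F a \<in> conn_sign_diag_graphs n"
    and iso: "\<And>a b. \<lbrakk>a \<in> A; b \<in> A; digraph_iso (with_proj (F a)) (with_proj (F b))\<rbrakk> \<Longrightarrow> a = b"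
  shows "card A \<le> cs n"
proof -
  let ?C = "conn_sign_diag_graphs n"
  let ?r = "{(G, H) \<in> ?C \<times> ?C. digraph_iso (with_proj G) (with_proj H)}"
  have "inj_on (\<lambda>a. ?r `` {F a}) A"
  proof (rule inj_onI)
    fix a b assume ab: "a \<in> A" "b \<in> A" and eq: "?r `` {F a} = ?r `` {F b}"
    have "pair_graph (F b)" using F[OF ab(2)] by (simp add: conn_sign_diag_graphs_def)
    then have "F b \<in> ?r `` {F b}" using F[OF ab(2)] digraph_iso_refl by blast
    then have "F b \<in> ?r `` {F a}" by (simp only: eq)
    then show "a = b" using iso[OF ab] by blast
  qed
  moreover have "(\<lambda>a. ?r `` {F a}) ` A \<subseteq> ?C // ?r"
    by (rule image_subsetI) (rule quotientI, rule F)
  moreover have "finite (?C // ?r)"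
    by (rule finite_quotient[OF finite_conn_sign_diag_graphs]) auto
  ultimately show ?thesis unfolding cs_def by (rule card_inj_on_le)
qed

text \<open>
  A set of \<open>q\<close> pairwise non-isomorphic Cayley graphs is recovered from the complement of their
  union as its set of components with more than one vertex, up to isomorphism.
\<close>

lemma choose_transversal_le_cs:
  assumes R: "R \<subseteq> good_sets d b" "finite R"
    and free: "\<And>S S'. \<lbrakk>S \<in> R; S' \<in> R; cayley_iso d S S'\<rbrakk> \<Longrightarrow> S = S'"
    and n: "(q + 1) * 2 ^ d \<le> n" and q: "0 < q" and d: "0 < d"
  shows "card R choose q \<le> cs n"
proof -
  let ?A = "{X. X \<subseteq> R \<and> card X = q}"
  have "\<forall>X\<in>?A. \<exists>e. bij_betw e {..<q} X"
    using finite_subset[OF _ R(2)] ex_bij_betw_nat_finite by (auto simp: lessThan_atLeast0)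
  from bchoice[OF this] obtain e where e: "\<And>X. X \<in> ?A \<Longrightarrow> bij_betw (e X) {..<q} X" by blast
  let ?F = "\<lambda>X. block_cograph n d q (e X)"
  have e_good: "e X i \<in> good_sets d b" "e X i \<in> R" "e X i \<in> X" if "X \<in> ?A" "i < q" for X i
  proof -
    show "e X i \<in> X" using e[OF that(1)] that(2) by (auto simp: bij_betw_def)
    then show "e X i \<in> R" using that by blast
    then show "e X i \<in> good_sets d b" using R by blast
  qed
  have qn: "q * 2 ^ d \<le> n" using n by simp
  have "card ?A \<le> cs n"
  proof (rule card_pairwise_nonisomorphic_le_cs[of _ ?F])
    fix X assume "X \<in> ?A"
    show "?F X \<in> conn_sign_diag_graphs n" by (rule block_cograph_in_conn_sign_diag_graphs[OF n q])
  next
    fix X Y assume X: "X \<in> ?A" and Y: "Y \<in> ?A" and iso: "digraph_iso (with_proj (?F X)) (with_proj (?F Y))"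
    have "X \<subseteq> Y"
    proof
      fix S assume "S \<in> X"
      then obtain i where i: "i < q" "S = e X i" using e[OF X] by (auto simp: bij_betw_def)
      have good: "0 \<notin> S" "\<And>k. k < d \<Longrightarrow> 2 ^ k \<in> S" if "S \<in> good_sets d b" for S
        using that by (auto simp: good_sets_def)
      have "\<exists>j<q. cayley_iso d (e X i) (e Y j)"
        using block_cograph_iso_imp_cayley_iso[OF iso qn d i(1) good(1)[OF e_good(1)[OF X i(1)]]
            good(2)[OF e_good(1)[OF X i(1)]] good(1)[OF e_good(1)[OF Y]]] .
      from this obtain j where j: "j < q" "cayley_iso d (e X i) (e Y j)" by blast
      have "S = e Y j"
        unfolding i(2) by (rule free[OF e_good(2)[OF X i(1)] e_good(2)[OF Y j(1)] j(2)])
      then show "S \<in> Y" using e_good(3)[OF Y j(1)] by (simp only:)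
    qed
    moreover have "Y \<subseteq> R" "card X = card Y" using X Y by simp_all
    ultimately show "X = Y" using card_subset_eq finite_subset[OF \<open>Y \<subseteq> R\<close> R(2)] by metis
  qed
  then show ?thesis using n_subsets[OF R(2)] by simp
qed

section \<open>Growth rate\<close>

text \<open>
  With \<open>N = 2 ^ d\<close>, the number of \<open>q\<close>-sets of isomorphism classes is at least
  \<open>2 ^ (q * (N - iso_loss d))\<close>.  The exponent lost consists of \<open>2 + d\<close> from restricting to good sets,
  \<open>d * (d * (6 * d + 4) + 1)\<close> from the size of an isomorphism class, and \<open>5\<close> from dividing by
  \<open>q \<le> 2 ^ 5\<close>.
\<close>

definition iso_loss :: "nat \<Rightarrow> nat" where
  "iso_loss d = 7 + d + d * (d * (6 * d + 4) + 1)"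

lemma eventually_iso_loss_le: "\<forall>\<^sub>F d in sequentially. 0 < d \<and> 13 * iso_loss d \<le> 2 ^ d"
proof -
  have "\<forall>\<^sub>F d in sequentially. 13 * (7 + real d + real d * (real d * (6 * real d + 4) + 1)) \<le> 2 ^ d"
    by real_asymp
  then have "\<forall>\<^sub>F d in sequentially. 13 * iso_loss d \<le> 2 ^ d"
  proof eventually_elim
    case (elim d)
    then have "real (13 * iso_loss d) \<le> real (2 ^ d)" by (simp add: iso_loss_def algebra_simps)
    then show ?case by (simp only: of_nat_le_iff)
  qed
  with eventually_gt_at_top[of "0::nat"] show ?thesis by (rule eventually_conj)
qed

text \<open>
  The fraction \<open>13 / 16\<close> is just above the binary logarithm of \<open>7 / 4\<close>: \<open>(7 / 4) ^ 16 \<le> 2 ^ 13\<close>.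
\<close>

lemma power_seven_quarters_le:
  assumes "13 * n \<le> 16 * m"
  shows "(7 / 4 :: real) ^ n \<le> 2 ^ m"
proof (rule power_le_imp_le_base)
  have "((7 / 4 :: real) ^ n) ^ Suc 15 = ((7 / 4) ^ 16) ^ n"
    by (simp flip: power_mult add: mult.commute)
  also have "\<dots> \<le> (2 ^ 13) ^ n" by (rule power_mono) (simp_all add: power_divide)
  also have "\<dots> = 2 ^ (13 * n)" by (simp only: power_mult)
  also have "\<dots> \<le> 2 ^ (16 * m)" using assms by (rule power_increasing) simp
  also have "\<dots> = (2 ^ m) ^ Suc 15" by (simp flip: power_mult add: mult.commute)
  finally show "((7 / 4 :: real) ^ n) ^ Suc 15 \<le> (2 ^ m) ^ Suc 15" .
qed simp

text \<open>
  With \<open>q = n div 2 ^ d - 1\<close>, at least one and less than two blocks of isolated vertices remain.  The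
  graph count \<open>2 ^ (q * (N - iso_loss d))\<close> then suffices since \<open>13 * (q + 2) / 16 \<le> q * (1 - 1 / 13)\<close> for
  all \<open>q \<ge> 15\<close>.
\<close>

lemma cs_ge_of_iso_loss_le:
  assumes d: "0 < d" and loss: "13 * iso_loss d \<le> 2 ^ d"
    and n: "2 ^ (d + 4) \<le> n" "n < 2 ^ (d + 5)"
  shows "(7 / 4) ^ n \<le> real (cs n)"
proof -
  define N :: nat where "N = 2 ^ d"
  define q where "q = n div N - 1"
  define K where "K = N - iso_loss d"
  define e where "e = d * (d * (6 * d + 4) + 1)"
  have N: "0 < N" by (simp add: N_def)
  have n': "16 * N \<le> n" "n < 32 * N" using n by (simp_all add: N_def power_add)
  then have "16 \<le> n div N" "n div N < 32"
    using N by (simp_all add: less_eq_div_iff_mult_less_eq div_less_iff_less_mult)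
  then have q: "15 \<le> q" "q \<le> 32" "n div N = q + 1" by (simp_all add: q_def)
  have qn: "(q + 1) * N \<le> n" "n < (q + 2) * N"
    using q(3) N div_mult_mod_eq[of n N] mod_less_divisor[OF N, of n] by (simp_all add: add_mult_distrib)
  have loss': "13 * iso_loss d \<le> N" "iso_loss d = 7 + d + e"
    using loss by (simp_all add: N_def iso_loss_def e_def)
  have "6 * d + 4 \<le> 13 * iso_loss d" by (simp add: iso_loss_def)
  then have "6 * d + 4 \<le> 2 ^ d" using loss by linarith
  then obtain R where R: "R \<subseteq> good_sets d (6 * d + 4)"
    "\<forall>S\<in>R. \<forall>S'\<in>R. cayley_iso d S S' \<longrightarrow> S = S'"
    "2 ^ (2 ^ d - 2 - d) \<le> card R * (2 ^ d) ^ (d * (6 * d + 4) + 1)"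
    by (rule exists_cayley_transversal)
  have free: "S = S'" if "S \<in> R" "S' \<in> R" "cayley_iso d S S'" for S S'
    using R(2) that by blast
  have "R \<subseteq> Pow {0<..<2 ^ d}" using R(1) by (auto simp: good_sets_def)
  then have finR: "finite R" by (rule finite_subset) simp
  have "2 ^ (N - 2 - d) = 2 ^ (K + 5) * (2 ^ e :: nat)"
    using loss' by (simp add: K_def flip: power_add)
  also have "(2 ^ e :: nat) = (2 ^ d) ^ (d * (6 * d + 4) + 1)"
    by (simp only: e_def power_mult)
  finally have "2 ^ (K + 5) * (2 ^ d) ^ (d * (6 * d + 4) + 1) \<le> card R * (2 ^ d) ^ (d * (6 * d + 4) + 1)"
    using R(3) by (simp only: N_def)
  then have T: "2 ^ (K + 5) \<le> card R" by (rule mult_right_le_imp_le) simp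
  have "q * 2 ^ K \<le> 32 * 2 ^ K" using q(2) by simp
  also have "32 * 2 ^ K = (2 ^ (K + 5) :: nat)" by (simp add: power_add)
  also note T
  finally have qT: "q * 2 ^ K \<le> card R" .
  have "13 * n \<le> 16 * (K * q)"
  proof -
    have "26 * N + 16 * (iso_loss d * q) \<le> 3 * (N * q)"
    proof -
      have "13 * (16 * (iso_loss d * q)) \<le> 16 * (N * q)" using loss'(1) by simp
      moreover have "N * 15 \<le> N * q" using q(1) by simp
      ultimately show ?thesis by linarith
    qed
    moreover have "K * q + iso_loss d * q = N * q"
      using loss'(1) by (simp add: K_def flip: add_mult_distrib)
    moreover have "n < N * q + 2 * N" using qn(2) by (simp add: algebra_simps)
    ultimately show ?thesis by linarith
  qed
  then have "(7 / 4) ^ n \<le> (2 ^ (K * q) :: real)" by (rule power_seven_quarters_le)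
  also have "\<dots> = (2 ^ K) ^ q" by (simp only: power_mult)
  also have "\<dots> \<le> (real (card R) / real q) ^ q"
  proof (rule power_mono)
    have "real (q * 2 ^ K) \<le> real (card R)" using qT by (simp only: of_nat_le_iff)
    then show "2 ^ K \<le> real (card R) / real q" using q(1) by (simp add: field_simps)
  qed simp
  also have "\<dots> \<le> real (card R choose q)"
  proof (rule binomial_ge_n_over_k_pow_k)
    have "q * 1 \<le> q * 2 ^ K" by (intro mult_left_mono) simp_all
    with qT show "q \<le> card R" by linarith
  qed
  also have "\<dots> \<le> real (cs n)"
    using choose_transversal_le_cs[OF R(1) finR free, of q n] qn(1) q(1) d by (simp add: N_def)
  finally show ?thesis .
qed

theorem theorem4:
  shows "\<forall>\<^sub>F n in sequentially. real (cs n) \<ge> (7 / 4) ^ n"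
proof -
  obtain D where D: "\<And>d. D \<le> d \<Longrightarrow> 0 < d \<and> 13 * iso_loss d \<le> 2 ^ d"
    using eventually_iso_loss_le unfolding eventually_sequentially by blast
  have "(7 / 4) ^ n \<le> real (cs n)" if n: "2 ^ (D + 4) \<le> n" for n
  proof -
    have "1 \<le> n" using n by (meson le_trans one_le_numeral one_le_power)
    then obtain k where k: "2 ^ k \<le> n" "n < 2 ^ (k + 1)" using ex_power_ivl1[of 2 n] by (meson order_refl)
    have "(2::nat) ^ (D + 4) < 2 ^ (k + 1)" using n k(2) by linarith
    then have "D + 4 < k + 1" by (simp only: power_strict_increasing_iff)
    then have d: "D \<le> k - 4" "k - 4 + 4 = k" "k - 4 + 5 = k + 1" by linarith+
    show ?thesis
      using cs_ge_of_iso_loss_le[of "k - 4" n, unfolded d(2,3)] D[OF d(1)] k by (elim conjE)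
  qed
  then show ?thesis unfolding eventually_sequentially by blast
qed

end
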